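(* Let $D$ be a dataset, let $\mathbb{U}\subseteq\mathbb{L}$ be a nonempty set of utility vectors, and let $r,k\ge1$ be integers. If there is a set $S\subseteq D$ of size $r$ with $\nabla_{\mathbb{U}}(S)=k$, then there is a set $R\subseteq \mathrm{Sky}_{\mathbb{U}}(D)$ with $|R|\le r$ and $\nabla_{\mathbb{U}}(R)\le k$.
   Context: A dataset $D$ is a finite set of $n$ distinct tuples in $[0,1]^d$ such that for each attribute $i$ some $t\in D$ has $t[i]=1$. $\mathbb{L}=\{u\in\mathbb{R}^d: u[i]\ge 0\ \forall i\}$ is the set of (linear) utility vectors. The utility of $t$ for $u$ is $w(u,t)=\sum_{i=1}^d u[i]t[i]$. The rank $\nabla_u(t)$ of $t\in D$ for $u$ is one plus the number of tuples $t'\in D$ with $w(u,t')>w(u,t)$. For nonempty $S\subseteq D$, $\nabla_u(S)=\min_{t\in S}\nabla_u(t)$ and $\nabla_{\mathbb{U}}(S)=\max_{u\in\mathbb{U}}\nabla_u(S)$. For $t,t'\in D$, $t$ $\mathbb{U}$-dominates $t'$, written $t\prec_{\mathbb{U}}t'$, if $w(u,t)\ge w(u,t')$ for all $u\in\mathbb{U}$ and $w(v,t)>w(v,t')$ for some $v\in\mathbb{U}$. The $\mathbb{U}$-skyline is $\mathrm{Sky}_{\mathbb{U}}(D)=\{t\in D: \text{there is no } t'\in D \text{ with } t'\prec_{\mathbb{U}}t\}$. *)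

theory Defs
  imports "HOL-Analysis.Analysis"
begin

definition dataset :: "(real ^ 'd::finite) set \<Rightarrow> bool" where
  "dataset D \<longleftrightarrow> finite D \<and> (\<forall>t\<in>D. \<forall>i. t $ i \<in> {0..1}) \<and> (\<forall>i. \<exists>t\<in>D. t $ i = 1)"

definition linear_utilities :: "(real ^ 'd::finite) set" where
  "linear_utilities = {u. \<forall>i. u $ i \<ge> 0}"

definition utility :: "real ^ 'd::finite \<Rightarrow> real ^ 'd \<Rightarrow> real" where
  "utility u t = (\<Sum>i\<in>UNIV. u $ i * t $ i)"

definition tuple_rank :: "(real ^ 'd::finite) set \<Rightarrow> real ^ 'd \<Rightarrow> real ^ 'd \<Rightarrow> nat" where
  "tuple_rank D u t = 1 + card {t' \<in> D. utility u t' > utility u t}"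

text \<open>Meaningful only for nonempty finite \<open>S\<close>, since \<^const>\<open>Min\<close> of the empty set is unspecified.\<close>

definition set_rank ::
    "(real ^ 'd::finite) set \<Rightarrow> real ^ 'd \<Rightarrow> (real ^ 'd) set \<Rightarrow> nat" where
  "set_rank D u S = Min (tuple_rank D u ` S)"

text \<open>\<open>U\<close> may be infinite, but for a dataset \<open>D\<close> and nonempty \<open>S \<subseteq> D\<close> all ranks lie between
  1 and \<^term>\<open>card D\<close>, so \<^const>\<open>Max\<close> is taken over a finite set.\<close>

definition max_rank ::
    "(real ^ 'd::finite) set \<Rightarrow> (real ^ 'd) set \<Rightarrow> (real ^ 'd) set \<Rightarrow> nat" where
  "max_rank D U S = Max ((\<lambda>u. set_rank D u S) ` U)"

definition dominates ::
    "(real ^ 'd::finite) set \<Rightarrow> real ^ 'd \<Rightarrow> real ^ 'd \<Rightarrow> bool" where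
  "dominates U t t' \<longleftrightarrow>
    (\<forall>u\<in>U. utility u t \<ge> utility u t') \<and> (\<exists>v\<in>U. utility v t > utility v t')"

definition skyline :: "(real ^ 'd::finite) set \<Rightarrow> (real ^ 'd) set \<Rightarrow> (real ^ 'd) set" where
  "skyline U D = {t \<in> D. \<not> (\<exists>t'\<in>D. dominates U t' t)}"

end

theory Submission
  imports Defs
begin

text \<open>Domination is a strict partial order on the finite set \<open>D\<close>, so above every tuple lies an
  undominated one that is at least as good for every utility vector of \<open>U\<close>. Replacing each
  tuple of \<open>S\<close> by such a skyline tuple can only lower ranks.\<close>

lemma dominates_trans:
  assumes "dominates U a b" and "dominates U b c"
  shows "dominates U a c"
  unfolding dominates_def
proof
  show "\<forall>u\<in>U. utility u c \<le> utility u a"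
    using assms order_trans unfolding dominates_def by blast
  \<comment> \<open>The strict witness \<open>v\<close> of the first domination survives, since
    \<open>b\<close> is at least as good as \<open>c\<close> at every vector of
    \<open>U\<close>.\<close>
  obtain v where "v \<in> U" and "utility v b < utility v a"
    using assms(1) by (auto simp: dominates_def)
  moreover from this(1) have "utility v c \<le> utility v b"
    using assms(2) by (simp add: dominates_def)
  ultimately show "\<exists>v\<in>U. utility v c < utility v a"
    by (meson order_le_less_trans)
qed

text \<open>A maximal element, with respect to domination, of the tuples weakly above
  \<open>t\<close> will do; this finite set contains \<open>t\<close> itself.\<close>

lemma skyline_tuple_above:
  assumes "finite D" and "t \<in> D"
  obtains s where "s \<in> skyline U D" and "\<And>u. u \<in> U \<Longrightarrow> utility u t \<le> utility u s"
proof -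
  define A where "A = {s \<in> D. \<forall>u\<in>U. utility u t \<le> utility u s}"
  have "finite A" and "A \<noteq> {}"
    using assms by (auto simp: A_def)
  moreover have "asymp_on A (\<lambda>a b. dominates U b a)"
    by (rule asymp_onI) (auto simp: dominates_def not_less)
  moreover have "transp_on A (\<lambda>a b. dominates U b a)"
    by (rule transp_onI) (blast intro: dominates_trans)
  \<comment> \<open>The arguments of \<open>dominates\<close> are swapped so that larger means
    dominating and a maximal element is one that nothing in \<open>A\<close> dominates.\<close>
  ultimately obtain m where m: "m \<in> A" "\<forall>x\<in>A. x \<noteq> m \<longrightarrow> \<not> dominates U x m"
    using Finite_Set.bex_max_element[of A "\<lambda>a b. dominates U b a"] by blast
  \<comment> \<open>Maximality in \<open>A\<close> extends to all of \<open>D\<close>: a dominator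
    of \<open>m\<close> is weakly above \<open>m\<close>, hence above \<open>t\<close>, so it lies
    in \<open>A\<close>.\<close>
  have "\<not> dominates U x m" if "x \<in> D" for x
  proof
    assume dom: "dominates U x m"
    then have "x \<noteq> m"
      by (auto simp: dominates_def)
    moreover have "utility u t \<le> utility u x" if "u \<in> U" for u
    proof -
      have "utility u t \<le> utility u m"
        using m(1) that by (simp add: A_def)
      also have "\<dots> \<le> utility u x"
        using dom that by (simp add: dominates_def)
      finally show ?thesis .
    qed
    then have "x \<in> A"
      using \<open>x \<in> D\<close> by (simp add: A_def)
    ultimately show False
      using m(2) dom by simp
  qed
  then have "m \<in> skyline U D"
    using m(1) by (auto simp: skyline_def A_def)
  then show thesis
    using m(1) that by (simp add: A_def)
qed

lemma tuple_rank_antimono: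
  assumes "finite D" and "utility u t \<le> utility u s"
  shows "tuple_rank D u s \<le> tuple_rank D u t"
  unfolding tuple_rank_def using assms by (auto intro!: card_mono)

lemma tuple_rank_le:
  assumes "finite D"
  shows "tuple_rank D u t \<le> 1 + card D"
  unfolding tuple_rank_def using assms by (auto intro: card_mono)

text \<open>As \<open>U\<close> may be infinite, this is what gives \<open>Max\<close> in
  \<open>max_rank\<close> its meaning. \<open>S\<close> may contain points outside \<open>D\<close>,
  which all of \<open>D\<close> can beat; hence the bound \<open>1 + card D\<close>.\<close>

lemma finite_set_ranks:
  assumes "finite D" and "finite S" and "S \<noteq> {}"
  shows "finite ((\<lambda>u. set_rank D u S) ` U)"
proof -
  have "set_rank D u S \<le> 1 + card D" for u
    unfolding set_rank_def using assms tuple_rank_le[OF assms(1)] by (auto simp: Min_le_iff)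
  then show ?thesis
    by (intro finite_subset[OF _ finite_atMost[of "1 + card D"]]) auto
qed

lemma set_rank_image_le:
  assumes "finite D" and "finite S" and "S \<noteq> {}"
    and "\<And>t. t \<in> S \<Longrightarrow> utility u t \<le> utility u (f t)"
  shows "set_rank D u (f ` S) \<le> set_rank D u S"
proof -
  \<comment> \<open>Pick the tuple \<open>t\<close> of best rank in \<open>S\<close>; its
    replacement \<open>f t\<close> ranks no worse and bounds the minimum over the image.\<close>
  have "Min (tuple_rank D u ` S) \<in> tuple_rank D u ` S"
    using assms by (intro Min_in) auto
  then obtain t where t: "t \<in> S" "set_rank D u S = tuple_rank D u t"
    by (auto simp: set_rank_def)
  have "set_rank D u (f ` S) \<le> tuple_rank D u (f t)"
    unfolding set_rank_def using assms(2) t(1) by (intro Min_le) auto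
  also have "\<dots> \<le> set_rank D u S"
    using t assms by (simp add: tuple_rank_antimono)
  finally show ?thesis .
qed

lemma max_rank_image_le:
  assumes "finite D" and "finite S" and "S \<noteq> {}" and "U \<noteq> {}"
    and "\<And>t u. t \<in> S \<Longrightarrow> u \<in> U \<Longrightarrow> utility u t \<le> utility u (f t)"
  shows "max_rank D U (f ` S) \<le> max_rank D U S"
  unfolding max_rank_def
proof (rule Max.boundedI)
  show "finite ((\<lambda>u. set_rank D u (f ` S)) ` U)"
    using assms by (intro finite_set_ranks) auto
  fix n assume "n \<in> (\<lambda>u. set_rank D u (f ` S)) ` U"
  then obtain u where u: "u \<in> U" and n: "n = set_rank D u (f ` S)" by blast
  \<comment> \<open>The comparison is made separately for each \<open>u\<close>; the maxima may be
    attained at different vectors.\<close>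
  have "n \<le> set_rank D u S"
    unfolding n using assms u by (intro set_rank_image_le) auto
  also have "\<dots> \<le> (MAX u\<in>U. set_rank D u S)"
    using u assms by (intro Max_ge finite_set_ranks) auto
  finally show "n \<le> (MAX u\<in>U. set_rank D u S)" .
qed (use assms in auto)

theorem theorem3:
  fixes D U :: "(real ^ 'd::finite) set" and r k :: nat
  assumes "dataset D"
    and "U \<subseteq> linear_utilities" and "U \<noteq> {}"
    and "r \<ge> 1" and "k \<ge> 1"
    and "\<exists>S. S \<subseteq> D \<and> card S = r \<and> max_rank D U S = k"
  shows "\<exists>R. R \<subseteq> skyline U D \<and> R \<noteq> {} \<and> card R \<le> r \<and> max_rank D U R \<le> k"
proof -
  obtain S where S: "S \<subseteq> D" "card S = r" "max_rank D U S = k"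
    using assms(6) by blast
  have "finite D"
    using assms(1) by (simp add: dataset_def)
  have "finite S"
    using S(1) \<open>finite D\<close> by (rule finite_subset)
  \<comment> \<open>Here \<open>r \<ge> 1\<close> enters: it keeps \<open>S\<close> and its image
    away from the unspecified \<open>Min\<close> of the empty set.\<close>
  have "S \<noteq> {}"
    using S(2) assms(4) by force
  have "\<exists>s. s \<in> skyline U D \<and> (\<forall>u\<in>U. utility u t \<le> utility u s)" if "t \<in> S" for t
  proof -
    have "t \<in> D"
      using that S(1) by blast
    then show ?thesis
      by (rule skyline_tuple_above[OF \<open>finite D\<close>, of t U]) blast
  qed
  then obtain f where f: "\<And>t. t \<in> S \<Longrightarrow> f t \<in> skyline U D"
      "\<And>t u. t \<in> S \<Longrightarrow> u \<in> U \<Longrightarrow> utility u t \<le> utility u (f t)"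
    by metis
  have "max_rank D U (f ` S) \<le> k"
    using max_rank_image_le[OF \<open>finite D\<close> \<open>finite S\<close> \<open>S \<noteq> {}\<close> assms(3) f(2)] S(3) by simp
  \<comment> \<open>Several tuples of \<open>S\<close> may share one replacement, so the size can
    drop below \<open>r\<close>.\<close>
  moreover have "card (f ` S) \<le> r"
    using card_image_le[OF \<open>finite S\<close>, of f] S(2) by simp
  ultimately show ?thesis
    using f(1) \<open>S \<noteq> {}\<close> by (intro exI[of _ "f ` S"]) auto
qed

end
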